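(* Let $\mathcal{T}$ be a lattice tiling by balls of an infinite-dimensional normed space $\mathcal{X}$. Then, for every $T_0\in\mathcal{T}$, \[ \big|\{T\in\mathcal{T}\colon T\cap T_0\neq\emptyset\}\big|=|\mathcal{T}|. \] In particular, no lattice tiling of $\mathcal{X}$ with balls is star-finite.
   Context: Normed spaces are real and $B_{\mathcal{X}}$ is the closed unit ball of $\mathcal{X}$. A tiling of $\mathcal{X}$ is a family of bodies (sets that are the closure of their non-empty interior) that covers $\mathcal{X}$ and whose members have mutually disjoint interiors. A lattice tiling by balls of $\mathcal{X}$ is a tiling of the form $\{d+B_{\mathcal{X}}\colon d\in\mathcal{D}\}$, where $\mathcal{D}$ is a (discrete) subgroup of $\mathcal{X}$. A family of subsets is star-finite if each of its members intersects only finitely many members of the family. $|S|$ denotes the cardinality of a set $S$. *)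

theory Defs
  imports "HOL-Analysis.Analysis"
begin

definition body :: "'a::topological_space set \<Rightarrow> bool" where
  "body S \<longleftrightarrow> interior S \<noteq> {} \<and> S = closure (interior S)"

definition tiling :: "'a::topological_space set set \<Rightarrow> bool" where
  "tiling \<T> \<longleftrightarrow> (\<forall>T\<in>\<T>. body T) \<and> \<Union>\<T> = UNIV \<and>
     pairwise (\<lambda>S T. interior S \<inter> interior T = {}) \<T>"

definition additive_subgroup :: "'a::group_add set \<Rightarrow> bool" where
  "additive_subgroup D \<longleftrightarrow> 0 \<in> D \<and> (\<forall>x\<in>D. \<forall>y\<in>D. x + y \<in> D) \<and> (\<forall>x\<in>D. - x \<in> D)"

(* Discreteness of D follows from disjointness of the interiors of the balls
   (distinct elements of D have distance at least 2); it is kept as part of the usual notion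
   of a lattice.  Since d \<mapsto> d + B is injective, the tiling can be taken to be a set of sets
   without identifying tiles that belong to different elements of D. *)
definition lattice_tiling_by_balls :: "'a::real_normed_vector set set \<Rightarrow> bool" where
  "lattice_tiling_by_balls \<T> \<longleftrightarrow> tiling \<T> \<and>
     (\<exists>D. additive_subgroup D \<and> discrete D \<and> \<T> = {(+) d ` cball 0 1 |d. d \<in> D})"

definition star_finite :: "'a set set \<Rightarrow> bool" where
  "star_finite \<F> \<longleftrightarrow> (\<forall>S\<in>\<F>. finite {T \<in> \<F>. T \<inter> S \<noteq> {}})"

definition infinite_dimensional :: "'a::real_vector itself \<Rightarrow> bool" where
  "infinite_dimensional _ \<longleftrightarrow> \<not> (\<exists>B :: 'a set. finite B \<and> span B = UNIV)"

end

theory Submission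
  imports Defs
begin

text \<open>Let \<open>N\<close> be the set of points of the lattice \<open>D\<close> of norm at most \<open>2\<close>; the tiles meeting \<open>d + B\<close> are the
  \<open>d + n + B\<close> with \<open>n \<in> N\<close>. For \<open>d \<in> D\<close> the point \<open>d / 2\<close> lies in some tile \<open>e + B\<close>, so
  \<open>d = n + 2 e\<close> with \<open>n \<in> N\<close>. Iterating, \<open>d = n\<^sub>0 + 2 n\<^sub>1 + \<dots> + 2\<^sup>k\<^sup>-\<^sup>1 n\<^sub>k\<^sub>-\<^sub>1 + 2\<^sup>k e\<close> for every \<open>k\<close>.
  Once \<open>\<parallel>d\<parallel> < 2\<^sup>k\<close>, the point \<open>e\<close> has distance less than \<open>1\<close> from \<open>- (n\<^sub>0 + \<dots> + 2\<^sup>k\<^sup>-\<^sup>1 n\<^sub>k\<^sub>-\<^sub>1) / 2\<^sup>k\<close>,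
  and as distinct points of \<open>D\<close> have distance at least \<open>2\<close>, the digits alone determine \<open>e\<close> and \<open>d\<close>.
  So \<open>D\<close> embeds into the set of lists over \<open>N\<close>, which settles the case of infinite \<open>N\<close>.
  If \<open>N\<close> is finite, the points \<open>(n\<^sub>0 + \<dots> + 2\<^sup>k\<^sup>-\<^sup>1 n\<^sub>k\<^sub>-\<^sub>1) / 2\<^sup>k\<close> all lie in the compact convex hull
  of \<open>N\<close>, so only finitely many \<open>e\<close> arise. Then \<open>D\<close> spans a finite-dimensional subspace, which is
  closed, and dense because \<open>D\<close> is \<open>1\<close>-dense.\<close>

section \<open>Cardinality of lists over an infinite set\<close>

lemma lists_lepoll_infinite:
  includes cardinal_syntax
  assumes "infinite A"
  shows "lists A \<lesssim> A"
proof -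
  \<comment> \<open>One more entry costs a product with \<open>A\<close>, which an infinite cardinal
    absorbs. The union over all lengths is then indexed by the naturals, which embed into
    \<open>A\<close>.\<close>
  have *: "|{xs \<in> lists A. length xs = n}| \<le>o |A|" for n
  proof (induction n)
    case 0
    have "{xs \<in> lists A. length xs = 0} = {[]}" by auto
    moreover have "A \<noteq> {}" using assms by auto
    ultimately show ?case by (simp add: card_of_singl_ordLeq)
  next
    case (Suc n)
    let ?L = "{xs \<in> lists A. length xs = n}"
    have "{xs \<in> lists A. length xs = Suc n} \<subseteq> (\<lambda>(x, xs). x # xs) ` (A \<times> ?L)"
      by (auto simp: length_Suc_conv image_iff)
    then have "|{xs \<in> lists A. length xs = Suc n}| \<le>o |A \<times> ?L|"
      by (rule surj_imp_ordLeq)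
    also have "|A \<times> ?L| \<le>o |A|"
      using card_of_Sigma_ordLeq_infinite[OF assms, of A "\<lambda>_. ?L"] Suc.IH
      by (simp add: card_of_mono1)
    finally show ?case .
  qed
  have "lists A = (\<Union>n. {xs \<in> lists A. length xs = n})" by auto
  moreover have "|\<Union>n. {xs \<in> lists A. length xs = n}| \<le>o |A|"
    using * assms by (intro card_of_UNION_ordLeq_infinite) (auto simp flip: infinite_iff_card_of_nat)
  ultimately show ?thesis
    by (simp add: lepoll_def card_of_ordLeq)
qed

section \<open>Closed and dense subspaces of normed spaces\<close>

lemma closed_span_insert:
  fixes S :: "'a::real_normed_vector set"
  assumes "closed (span S)"
  shows "closed (span (insert a S))"
proof (cases "a \<in> span S")
  case True
  then show ?thesis using assms by (simp add: span_redundant)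
next
  case False
  define \<delta> where "\<delta> = infdist a (span S)"
  have "\<delta> > 0"
    unfolding \<delta>_def using infdist_pos_not_in_closed[OF assms _ False] span_0 by blast
  \<comment> \<open>Dividing by \<open>- t\<close> turns \<open>w - t *\<^sub>R a\<close> into a
    point of \<open>span S\<close> at distance \<open>norm w / \<bar>t\<bar>\<close> from
    \<open>a\<close>; this distance is at least \<open>\<delta>\<close>.\<close>
  have coeff_le: "\<bar>t\<bar> * \<delta> \<le> norm w" if "w - t *\<^sub>R a \<in> span S" for t w
  proof (cases "t = 0")
    case False
    have "(- 1 / t) *\<^sub>R (w - t *\<^sub>R a) \<in> span S" using that by (rule span_scale)
    also have "(- 1 / t) *\<^sub>R (w - t *\<^sub>R a) = a - (1 / t) *\<^sub>R w"
      using False by (simp add: algebra_simps)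
    finally have "\<delta> \<le> dist a (a - (1 / t) *\<^sub>R w)"
      unfolding \<delta>_def by (simp add: infdist_le2)
    also have "\<dots> = norm w / \<bar>t\<bar>" by (simp add: dist_norm)
    finally show ?thesis using False by (simp add: field_simps)
  qed simp
  show ?thesis
    unfolding closed_sequential_limits
  proof clarify
    fix w l assume "\<forall>n. w n \<in> span (insert a S)" and lim: "w \<longlonglongrightarrow> l"
    then obtain t where t: "\<And>n. w n - t n *\<^sub>R a \<in> span S"
      unfolding span_insert by simp metis
    \<comment> \<open>By \<open>coeff_le\<close>, applied to differences of members of
      \<open>w\<close>, the coefficients inherit the Cauchy property. Completeness enters only for
      the real sequence \<open>t\<close>, since the limit \<open>l\<close> of \<open>w\<close> is
      given.\<close>
    have "Cauchy t"
    proof (rule metric_CauchyI)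
      fix e :: real assume "e > 0"
      with \<open>\<delta> > 0\<close> lim obtain M where M: "\<And>m n. m \<ge> M \<Longrightarrow> n \<ge> M \<Longrightarrow> dist (w m) (w n) < e * \<delta>"
        using metric_CauchyD[OF LIMSEQ_imp_Cauchy[OF lim], of "e * \<delta>"] by auto
      have "dist (t m) (t n) < e" if "m \<ge> M" "n \<ge> M" for m n
      proof -
        have "(w m - w n) - (t m - t n) *\<^sub>R a \<in> span S"
          using span_diff[OF t[of m] t[of n]] by (simp add: algebra_simps)
        from coeff_le[OF this] M[OF that] have "dist (t m) (t n) * \<delta> < e * \<delta>"
          by (simp add: dist_norm)
        then show ?thesis using \<open>\<delta> > 0\<close> by simp
      qed
      then show "\<exists>M. \<forall>m\<ge>M. \<forall>n\<ge>M. dist (t m) (t n) < e" by blast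
    qed
    then obtain s where "t \<longlonglongrightarrow> s" using convergent_eq_Cauchy by blast
    then have "(\<lambda>n. w n - t n *\<^sub>R a) \<longlonglongrightarrow> l - s *\<^sub>R a" using lim by (intro tendsto_intros)
    then have "l - s *\<^sub>R a \<in> span S"
      using t by (rule closed_sequentially[OF assms, rotated])
    then show "l \<in> span (insert a S)" unfolding span_insert by blast
  qed
qed

lemma closed_span_finite:
  fixes S :: "'a::real_normed_vector set"
  assumes "finite S"
  shows "closed (span S)"
  using assms by induction (auto intro: closed_span_insert)

text \<open>Approximating \<open>c *\<^sub>R x\<close> within \<open>r\<close> and scaling back
  inside the subspace approximates \<open>x\<close> within \<open>r / c\<close>, so \<open>V\<close>
  is dense.\<close>

lemma subspace_covering_radius_imp_UNIV:
  fixes V :: "'a::real_normed_vector set"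
  assumes "subspace V" "closed V" and cover: "\<And>x. \<exists>v\<in>V. dist x v \<le> r"
  shows "V = UNIV"
proof -
  have "r \<ge> 0" using cover order_trans[OF zero_le_dist] by blast
  have "x \<in> closure V" for x
    unfolding closure_approachable
  proof safe
    fix e :: real assume "e > 0"
    \<comment> \<open>The summand 1 keeps \<open>c\<close> positive when \<open>r = 0\<close> and
      makes \<open>r / c < e\<close> strict.\<close>
    define c where "c = (r + 1) / e"
    have c: "c > 0" "r / c < e" using \<open>e > 0\<close> \<open>r \<ge> 0\<close> by (auto simp: c_def field_simps)
    obtain v where v: "v \<in> V" "dist (c *\<^sub>R x) v \<le> r" using cover by blast
    have "(1 / c) *\<^sub>R v - x = (1 / c) *\<^sub>R (v - c *\<^sub>R x)"
      using c(1) by (simp add: algebra_simps)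
    then have "dist ((1 / c) *\<^sub>R v) x = dist (c *\<^sub>R x) v / c"
      using c(1) by (simp add: dist_norm norm_minus_commute)
    also have "\<dots> \<le> r / c" using v c by (simp add: divide_right_mono)
    finally show "\<exists>y\<in>V. dist y x < e"
      using c v subspace_scale[OF assms(1), of v "1 / c"] by force
  qed
  then show ?thesis using \<open>closed V\<close> by auto
qed

section \<open>Binary expansions with vectors as digits\<close>

primrec binary_value :: "'a::real_vector list \<Rightarrow> 'a" where
  "binary_value [] = 0"
| "binary_value (n # ns) = n + 2 *\<^sub>R binary_value ns"

lemma binary_value_in_span: "ns \<in> lists N \<Longrightarrow> binary_value ns \<in> span N"
  by (induction ns) (auto intro: span_add span_scale span_base span_0)

text \<open>For \<open>k\<close> digits the weights 1, 2, ..., \<open>2 ^ (k - 1)\<close> add up to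
  \<open>2 ^ k - 1\<close>, so the value is that multiple of a point of the hull. After division by
  \<open>2 ^ k\<close> the missing weight \<open>1 / 2 ^ k\<close> goes to 0.\<close>

lemma binary_value_in_convex_hull:
  assumes "ns \<in> lists N" and "0 \<in> N"
  shows "(1 / 2 ^ length ns) *\<^sub>R binary_value ns \<in> convex hull N"
proof -
  have "\<exists>c \<in> convex hull N. binary_value ns = (2 ^ length ns - 1) *\<^sub>R c"
    using assms(1)
  proof induction
    case Nil
    then show ?case using assms(2) hull_inc by fastforce
  next
    case (Cons n ns)
    then obtain c where c: "c \<in> convex hull N" "binary_value ns = (2 ^ length ns - 1) *\<^sub>R c"
      by blast
    \<comment> \<open>Since \<open>m - 1 = 2 * (2 ^ length ns - 1)\<close>, the doubled value of the
      tail is \<open>(m - 1) *\<^sub>R c\<close>.\<close>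
    define m :: real where "m = 2 ^ length (n # ns) - 1"
    have "m \<ge> 1" using one_le_power[of "2::real" "length ns"] by (simp add: m_def)
    have "(1 / m) *\<^sub>R n + ((m - 1) / m) *\<^sub>R c \<in> convex hull N"
      using \<open>m \<ge> 1\<close> c(1) Cons.hyps by (intro convexD) (auto simp: hull_inc diff_divide_distrib)
    moreover have "m *\<^sub>R ((1 / m) *\<^sub>R n + ((m - 1) / m) *\<^sub>R c) = n + (m - 1) *\<^sub>R c"
      using \<open>m \<ge> 1\<close> by (simp add: scaleR_add_right)
    moreover have "binary_value (n # ns) = n + (m - 1) *\<^sub>R c"
      using c(2) by (simp add: m_def right_diff_distrib)
    ultimately have "\<exists>c \<in> convex hull N. binary_value (n # ns) = m *\<^sub>R c" by metis
    then show ?case unfolding m_def .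
  qed
  then obtain c where c: "c \<in> convex hull N" "binary_value ns = (2 ^ length ns - 1) *\<^sub>R c"
    by blast
  let ?p = "2 ^ length ns :: real"
  have "((?p - 1) / ?p) *\<^sub>R c + (1 / ?p) *\<^sub>R 0 \<in> convex hull N"
    using c(1) assms(2) by (intro convexD) (auto simp: hull_inc diff_divide_distrib)
  then show ?thesis using c(2) by simp
qed

locale ball_lattice =
  fixes D :: "'a::real_normed_vector set"
  assumes subgroup: "additive_subgroup D"
    and separated: "d \<in> D \<Longrightarrow> e \<in> D \<Longrightarrow> dist d e < 2 \<Longrightarrow> d = e"
    and covering: "\<exists>d\<in>D. dist x d \<le> 1"
begin

text \<open>The bound 2 serves twice: closed unit balls meet exactly when their centres are at most
  2 apart, and the error 1 made in rounding \<open>d / 2\<close> to the lattice doubles to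
  2.\<close>

definition short_vectors :: "'a set" where
  "short_vectors = {n \<in> D. norm n \<le> 2}"

lemma zero_mem: "0 \<in> D"
  using subgroup by (simp add: additive_subgroup_def)

lemma add_mem: "d \<in> D \<Longrightarrow> e \<in> D \<Longrightarrow> d + e \<in> D"
  using subgroup by (simp add: additive_subgroup_def)

lemma diff_mem: "d \<in> D \<Longrightarrow> e \<in> D \<Longrightarrow> d - e \<in> D"
  using subgroup by (metis additive_subgroup_def diff_conv_add_uminus)

lemma halving:
  assumes "d \<in> D"
  shows "\<exists>n\<in>short_vectors. \<exists>e\<in>D. d = n + 2 *\<^sub>R e"
proof -
  obtain e where e: "e \<in> D" "dist ((1/2) *\<^sub>R d) e \<le> 1" using covering by blast
  have "d - 2 *\<^sub>R e = 2 *\<^sub>R ((1/2) *\<^sub>R d - e)" by (simp add: algebra_simps)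
  then have "norm (d - 2 *\<^sub>R e) \<le> 2" using e(2) by (simp add: dist_norm)
  moreover have "d - 2 *\<^sub>R e \<in> D"
    using assms e(1) by (simp add: scaleR_2 diff_mem add_mem)
  ultimately show ?thesis using e(1) by (force simp: short_vectors_def)
qed

lemma binary_expansion:
  "d \<in> D \<Longrightarrow> \<exists>ns\<in>lists short_vectors. length ns = k \<and>
     (\<exists>e\<in>D. d = binary_value ns + 2 ^ k *\<^sub>R e)"
proof (induction k arbitrary: d)
  case 0
  then show ?case by (intro bexI[of _ "[]"]) auto
next
  case (Suc k)
  obtain n d' where n: "n \<in> short_vectors" "d' \<in> D" "d = n + 2 *\<^sub>R d'"
    using halving[OF Suc.prems] by blast
  obtain ns e where ns: "ns \<in> lists short_vectors" "length ns = k" "e \<in> D"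
    "d' = binary_value ns + 2 ^ k *\<^sub>R e"
    using Suc.IH[OF n(2)] by blast
  show ?case using n ns by (intro bexI[of _ "n # ns"]) (auto simp: scaleR_add_right)
qed

text \<open>Dividing the expansion by \<open>2 ^ k\<close> leaves the error
  \<open>norm d / 2 ^ k\<close>, which is small for large \<open>k\<close>. Counting uses
  \<open>r = 1\<close>; the compactness argument uses \<open>r = 1/2\<close>, to leave room for a
  net of radius 1/2.\<close>

lemma approximate_binary_expansion:
  assumes "d \<in> D" "r > 0"
  obtains ns e where "ns \<in> lists short_vectors" "e \<in> D"
    "d = binary_value ns + 2 ^ length ns *\<^sub>R e"
    "dist e (- ((1 / 2 ^ length ns) *\<^sub>R binary_value ns)) < r"
proof -
  obtain k where k: "norm d / r < 2 ^ k" using real_arch_pow[of 2] by auto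
  obtain ns e where ns: "ns \<in> lists short_vectors" "length ns = k" "e \<in> D"
    "d = binary_value ns + 2 ^ k *\<^sub>R e"
    using binary_expansion[OF assms(1)] by blast
  have "(1 / 2 ^ k) *\<^sub>R d = e - (- ((1 / 2 ^ k) *\<^sub>R binary_value ns))"
    by (simp add: ns(4) scaleR_add_right)
  then have "dist e (- ((1 / 2 ^ k) *\<^sub>R binary_value ns)) = norm d / 2 ^ k"
    unfolding dist_norm by (metis dist_norm norm_scaleR abs_of_pos divide_pos_pos zero_less_one
        zero_less_power zero_less_numeral mult.left_neutral times_divide_eq_left)
  also have "\<dots> < r" using k assms(2) by (simp add: field_simps)
  finally show ?thesis using that ns by blast
qed

lemma lepoll_lists_short_vectors: "D \<lesssim> lists short_vectors"
proof -
  have "\<forall>d\<in>D. \<exists>ns. ns \<in> lists short_vectors \<and> (\<exists>e\<in>D. d = binary_value ns + 2 ^ length ns *\<^sub>R e \<and>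
      dist e (- ((1 / 2 ^ length ns) *\<^sub>R binary_value ns)) < 1)"
    by (metis approximate_binary_expansion zero_less_one)
  from bchoice[OF this] obtain f where f: "\<And>d. d \<in> D \<Longrightarrow> f d \<in> lists short_vectors"
    "\<And>d. d \<in> D \<Longrightarrow> \<exists>e\<in>D. d = binary_value (f d) + 2 ^ length (f d) *\<^sub>R e \<and>
      dist e (- ((1 / 2 ^ length (f d)) *\<^sub>R binary_value (f d))) < 1"
    by blast
  have "inj_on f D"
  proof (rule inj_onI)
    fix d d' assume d: "d \<in> D" and d': "d' \<in> D" and eq: "f d = f d'"
    \<comment> \<open>The list fixes its own length, so \<open>d\<close> and \<open>d'\<close> share
      the power of 2, and \<open>e\<close> and \<open>e'\<close> lie within 1 of the same
      point.\<close>
    then obtain e e' where e: "e \<in> D" "d = binary_value (f d) + 2 ^ length (f d) *\<^sub>R e"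
        "dist e (- ((1 / 2 ^ length (f d)) *\<^sub>R binary_value (f d))) < 1"
      and e': "e' \<in> D" "d' = binary_value (f d) + 2 ^ length (f d) *\<^sub>R e'"
        "dist e' (- ((1 / 2 ^ length (f d)) *\<^sub>R binary_value (f d))) < 1"
      using f(2)[OF d] f(2)[OF d', folded eq] by blast
    have "dist e e' < 2" using dist_triangle_less_add[OF e(3) e'(3)] by simp
    then have "e = e'" using e(1) e'(1) separated by blast
    then show "d = d'" by (metis e(2) e'(2))
  qed
  then show ?thesis using f(1) by (auto simp: lepoll_def)
qed

lemma finite_short_vectors_imp_finite_dimensional:
  assumes "finite short_vectors"
  shows "\<exists>S :: 'a set. finite S \<and> span S = UNIV"
proof -
  have "compact (convex hull short_vectors)" using assms by (rule finite_imp_compact_convex_hull)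
  then obtain F where F: "finite F" "convex hull short_vectors \<subseteq> (\<Union>f\<in>F. ball f (1/2))"
    using seq_compact_imp_totally_bounded[of "convex hull short_vectors"] compact_imp_seq_compact
    by (metis half_gt_zero_iff zero_less_one)
  \<comment> \<open>\<open>M\<close> catches every remainder \<open>e\<close>: 1/2 comes from the
    expansion and 1/2 from the net \<open>F\<close>. Each set in the union has at most one element,
    because two would be less than 2 apart.\<close>
  define M where "M = (\<Union>f\<in>F. {e \<in> D. dist e (- f) < 1})"
  have "finite {e \<in> D. dist e c < 1}" for c
  proof (cases "{e \<in> D. dist e c < 1} = {}")
    case False
    then obtain e0 where "e0 \<in> D" "dist e0 c < 1" by blast
    then have "{e \<in> D. dist e c < 1} \<subseteq> {e0}"
      using separated dist_triangle_less_add[of _ c 1 e0 1] by auto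
    then show ?thesis by (rule finite_subset) simp
  qed (metis finite.emptyI)
  then have "finite M" using F(1) by (simp add: M_def)
  define S where "S = short_vectors \<union> M"
  have "finite S" using assms \<open>finite M\<close> by (simp add: S_def)
  have "d \<in> span S" if d: "d \<in> D" for d
  proof -
    obtain ns e where ns: "ns \<in> lists short_vectors" "e \<in> D"
      "d = binary_value ns + 2 ^ length ns *\<^sub>R e"
      "dist e (- ((1 / 2 ^ length ns) *\<^sub>R binary_value ns)) < 1/2"
      by (rule approximate_binary_expansion[OF d, of "1/2"]) auto
    define c where "c = (1 / 2 ^ length ns) *\<^sub>R binary_value ns"
    have "c \<in> convex hull short_vectors"
      unfolding c_def using ns(1) zero_mem
      by (intro binary_value_in_convex_hull) (auto simp: short_vectors_def)
    then obtain f where f: "f \<in> F" "dist f c < 1/2" using F(2) by auto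
    have "dist (- f) (- c) < 1/2" using f(2) by (simp add: dist_minus)
    then have "dist e (- f) < 1"
      using dist_triangle_less_add[of e "- c" "1/2" "- f" "1/2"] ns(4) by (simp add: c_def)
    then have "e \<in> S" using f(1) ns(2) by (auto simp: M_def S_def)
    moreover have "binary_value ns \<in> span S"
      using binary_value_in_span[OF ns(1)] span_mono[of short_vectors S] by (auto simp: S_def)
    ultimately show ?thesis
      unfolding ns(3) by (intro span_add span_scale) (auto intro: span_base)
  qed
  then have "\<exists>v\<in>span S. dist x v \<le> 1" for x using covering by blast
  then have "span S = UNIV"
    using subspace_covering_radius_imp_UNIV[OF subspace_span closed_span_finite[OF \<open>finite S\<close>]]
    by blast
  then show ?thesis using \<open>finite S\<close> by blast
qed

lemma short_vectors_eqpoll: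
  assumes "infinite_dimensional TYPE('a)"
  shows "infinite short_vectors" and "short_vectors \<approx> D"
proof -
  show inf: "infinite short_vectors"
    using assms finite_short_vectors_imp_finite_dimensional by (auto simp: infinite_dimensional_def)
  show "short_vectors \<approx> D"
  proof (rule lepoll_antisym)
    show "short_vectors \<lesssim> D" by (rule subset_imp_lepoll) (auto simp: short_vectors_def)
    show "D \<lesssim> short_vectors"
      using lepoll_lists_short_vectors lists_lepoll_infinite[OF inf] by (rule lepoll_trans)
  qed
qed

end

section \<open>From tiles to their centres\<close>

lemma cball_center_unique:
  fixes c d :: "'a::real_normed_vector"
  assumes "cball c 1 = cball d 1"
  shows "c = d"
proof (rule ccontr)
  assume "c \<noteq> d"
  \<comment> \<open>\<open>d + u\<close> is the point of the ball around \<open>d\<close> farthest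
    from \<open>c\<close>, at distance \<open>norm (d - c) + 1\<close>.\<close>
  define u where "u = (1 / norm (d - c)) *\<^sub>R (d - c)"
  have "d + u \<in> cball d 1" using \<open>c \<noteq> d\<close> by (simp add: u_def dist_norm)
  then have "dist c (d + u) \<le> 1" using assms by auto
  moreover have "d + u - c = (1 + 1 / norm (d - c)) *\<^sub>R (d - c)"
    by (simp add: u_def algebra_simps)
  then have "norm (d + u - c) = (1 + 1 / norm (d - c)) * norm (d - c)"
    by (metis abs_of_nonneg norm_scaleR add_nonneg_nonneg zero_le_one divide_nonneg_nonneg norm_ge_zero)
  then have "norm (d + u - c) = norm (d - c) + 1"
    using \<open>c \<noteq> d\<close> by (simp add: distrib_right)
  ultimately show False using \<open>c \<noteq> d\<close> by (simp add: dist_norm norm_minus_commute)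
qed

lemma lattice_tiling_by_ballsE:
  fixes \<T> :: "'a::real_normed_vector set set"
  assumes "lattice_tiling_by_balls \<T>"
  obtains D where "ball_lattice D" "\<T> = (\<lambda>d. cball d 1) ` D"
proof -
  from assms obtain D where D: "additive_subgroup D" "\<T> = {(+) d ` cball 0 1 |d. d \<in> D}"
    and til: "\<Union>\<T> = UNIV" "pairwise (\<lambda>S T. interior S \<inter> interior T = {}) \<T>"
    unfolding lattice_tiling_by_balls_def tiling_def by blast
  have \<T>: "\<T> = (\<lambda>d. cball d 1) ` D"
    unfolding D(2) by (auto simp: cball_translation[symmetric])
  have "ball_lattice D"
  proof
    fix d e assume de: "d \<in> D" "e \<in> D" "dist d e < 2"
    let ?m = "midpoint d e"
    have "?m \<in> ball d 1" "?m \<in> ball e 1" using de(3) by (auto simp: dist_midpoint)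
    then have "?m \<in> interior (cball d 1)" "?m \<in> interior (cball e 1)"
      using interior_maximal[OF ball_subset_cball open_ball] by blast+
    \<comment> \<open>The midpoint lies in both interiors, and disjointness holds for distinct
      tiles. This identifies the tiles only; the centres need
      \<open>cball_center_unique\<close>.\<close>
    then have "cball d 1 = cball e 1" using til(2) de unfolding \<T> pairwise_def by blast
    then show "d = e" by (rule cball_center_unique)
  next
    fix x
    show "\<exists>d\<in>D. dist x d \<le> 1" using til(1) unfolding \<T> by (fastforce simp: dist_commute set_eq_iff)
  qed (fact D(1))
  then show ?thesis using \<T> that by blast
qed

lemma cball_meets_cball_iff:
  fixes c d :: "'a::real_normed_vector"
  shows "cball c 1 \<inter> cball d 1 \<noteq> {} \<longleftrightarrow> dist c d \<le> 2"
proof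
  assume "cball c 1 \<inter> cball d 1 \<noteq> {}"
  then obtain x where "dist c x \<le> 1" "dist d x \<le> 1" by auto
  then show "dist c d \<le> 2" using dist_triangle2[of c d x] by simp
next
  assume "dist c d \<le> 2"
  then have "midpoint c d \<in> cball c 1 \<inter> cball d 1" by (auto simp: dist_midpoint)
  then show "cball c 1 \<inter> cball d 1 \<noteq> {}" by blast
qed

theorem corollary4p5:
  assumes "infinite_dimensional TYPE('a::real_normed_vector)"
  shows "(\<forall>\<T> :: 'a set set. lattice_tiling_by_balls \<T> \<longrightarrow>
            (\<forall>T\<^sub>0\<in>\<T>. {T \<in> \<T>. T \<inter> T\<^sub>0 \<noteq> {}} \<approx> \<T>)) \<and>
         \<not> (\<exists>\<T> :: 'a set set. lattice_tiling_by_balls \<T> \<and> star_finite \<T>)"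
proof -
  have star: "{T \<in> \<T>. T \<inter> T\<^sub>0 \<noteq> {}} \<approx> \<T> \<and> infinite {T \<in> \<T>. T \<inter> T\<^sub>0 \<noteq> {}}"
    if \<T>: "lattice_tiling_by_balls \<T>" and "T\<^sub>0 \<in> \<T>" for \<T> :: "'a set set" and T\<^sub>0
  proof -
    obtain D where "ball_lattice D" and D: "\<T> = (\<lambda>d. cball d 1) ` D"
      using \<T> by (rule lattice_tiling_by_ballsE)
    interpret ball_lattice D by fact
    obtain d0 where d0: "d0 \<in> D" "T\<^sub>0 = cball d0 1" using \<open>T\<^sub>0 \<in> \<T>\<close> D by blast
    have inj: "inj (\<lambda>d::'a. cball d 1)" by (rule injI) (rule cball_center_unique)
    have "{T \<in> \<T>. T \<inter> T\<^sub>0 \<noteq> {}} = (\<lambda>d. cball d 1) ` {d \<in> D. dist d d0 \<le> 2}"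
      unfolding D d0(2) cball_meets_cball_iff[symmetric] by blast
    \<comment> \<open>Translation by \<open>d0\<close> preserves the lattice, so all tiles have the
      same number of neighbours.\<close>
    also have "{d \<in> D. dist d d0 \<le> 2} = (\<lambda>n. d0 + n) ` short_vectors"
    proof (intro set_eqI iffI)
      fix d assume "d \<in> {d \<in> D. dist d d0 \<le> 2}"
      then have "d - d0 \<in> short_vectors" using d0(1) by (auto simp: short_vectors_def dist_norm diff_mem)
      then show "d \<in> (\<lambda>n. d0 + n) ` short_vectors" by (rule rev_image_eqI) simp
    qed (use d0(1) in \<open>auto simp: short_vectors_def dist_norm add_mem\<close>)
    finally have image: "{T \<in> \<T>. T \<inter> T\<^sub>0 \<noteq> {}} = (\<lambda>d. cball d 1) ` (\<lambda>n. d0 + n) ` short_vectors" .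
    have "{T \<in> \<T>. T \<inter> T\<^sub>0 \<noteq> {}} \<approx> (\<lambda>n. d0 + n) ` short_vectors"
      unfolding image by (rule inj_on_image_eqpoll_self) (rule inj_on_subset[OF inj subset_UNIV])
    also have "\<dots> \<approx> short_vectors" by (rule inj_on_image_eqpoll_self) simp
    finally have short: "{T \<in> \<T>. T \<inter> T\<^sub>0 \<noteq> {}} \<approx> short_vectors" .
    also have "short_vectors \<approx> D" using assms by (rule short_vectors_eqpoll)
    also have "D \<approx> \<T>"
      unfolding D by (rule eqpoll_sym, rule inj_on_image_eqpoll_self)
        (rule inj_on_subset[OF inj subset_UNIV])
    finally show ?thesis
      using short_vectors_eqpoll(1)[OF assms] eqpoll_finite_iff[OF short] by simp
  qed
  have "\<not> star_finite \<T>" if \<T>: "lattice_tiling_by_balls \<T>" for \<T> :: "'a set set"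
  proof -
    \<comment> \<open>The empty family would be star-finite vacuously; a tiling has a member because
      it covers the space.\<close>
    have "\<T> \<noteq> {}" using \<T> unfolding lattice_tiling_by_balls_def tiling_def by auto
    then show ?thesis using star[OF \<T>] unfolding star_finite_def by blast
  qed
  with star show ?thesis by blast
qed

end
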